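(* Let $K$ be a field, let $P=K[x_1,\dots,x_n]$ with tuple of indeterminates $X=(x_1,\dots,x_n)$, let $I=\langle G\rangle$ be an ideal in $P$ generated by a tuple of polynomials $G=(g_1,\dots,g_r)$, let $Z=(z_1,\dots,z_s)$ be a tuple of distinct indeterminates in $X$, and let $F=(f_1,\dots,f_s)$ be a coherently $Z$-separating tuple of polynomials in $I$. Then the tuple $\widehat{G}$ obtained by rewriting $G$ using $F$ is a system of generators of the elimination ideal $I\cap K[X\setminus Z]$ (as an ideal of $K[X\setminus Z]$).
   Context: A tuple $F=(f_1,\dots,f_s)\in P^s$ is coherently $Z$-separating if $f_i=z_i-h_i$ with polynomials $h_i\in P$ such that $z_i$ divides no term in $\mathrm{Supp}(h_j)$ (the set of power products occurring in $h_j$ with nonzero coefficient) for all $i,j\in\{1,\dots,s\}$. Rewriting a polynomial $g\in P$ using $F$ means replacing each occurrence of $z_i$ in $g$ by $h_i$, for $i=1,\dots,s$; the result is denoted $\hat g$. The tuple obtained by rewriting $G=(g_1,\dots,g_r)$ using $F$ is $\widehat{G}=(\hat g_1,\dots,\hat g_r)$. $X\setminus Z$ denotes the tuple of indeterminates in $X$ which are not in $Z$. *)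

theory Defs
  imports "HOL-Library.Poly_Mapping" "HOL-Algebra.Ideal"
begin

text \<open>
  A power product is its finitely supported exponent vector, written additively, and a polynomial
  is a finitely supported function from power products to coefficients; its support
  \<open>Supp\<close> is \<^const>\<open>Poly_Mapping.keys\<close>. The indeterminate \<open>x\<^sub>i\<close> is given by
  its index \<open>i\<close>.
\<close>

type_synonym pp = "nat \<Rightarrow>\<^sub>0 nat"
type_synonym 'k mpoly = "pp \<Rightarrow>\<^sub>0 'k"

text \<open>
  Divisibility of power products. This is not \<open>(dvd)\<close> on \<^typ>\<open>pp\<close>, which would
  refer to the convolution product of exponent vectors.
\<close>

definition pp_dvd :: "pp \<Rightarrow> pp \<Rightarrow> bool" where
  "pp_dvd s t \<longleftrightarrow> (\<exists>u. t = s + u)"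

definition Const :: "'k \<Rightarrow> 'k::field mpoly" where
  "Const c = Poly_Mapping.single 0 c"

definition Var :: "nat \<Rightarrow> 'k::field mpoly" where
  "Var i = Poly_Mapping.single (Poly_Mapping.single i 1) 1"

definition poly_ring :: "nat set \<Rightarrow> 'k::field mpoly ring" where
  "poly_ring V =
     \<lparr>carrier = {p. \<forall>t\<in>Poly_Mapping.keys p. Poly_Mapping.keys t \<subseteq> V},
      monoid.mult = (*), one = 1, zero = 0, add = (+)\<rparr>"

definition subst_vars :: "(nat \<Rightarrow> 'k::field mpoly) \<Rightarrow> 'k mpoly \<Rightarrow> 'k mpoly" where
  "subst_vars \<sigma> g =
     (\<Sum>t\<in>Poly_Mapping.keys g.
        Const (Poly_Mapping.lookup g t) *
        (\<Prod>i\<in>Poly_Mapping.keys t. \<sigma> i ^ Poly_Mapping.lookup t i))"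

text \<open>
  Tuples are lists, indexed from 0; \<open>Z\<close> is the list of the indices of the indeterminates
  \<open>z\<^sub>i\<close>, and \<open>P\<close> is the polynomial ring containing the \<open>f\<^sub>i\<close>.
\<close>

definition coherently_separating ::
    "'k::field mpoly ring \<Rightarrow> nat list \<Rightarrow> 'k mpoly list \<Rightarrow> bool" where
  "coherently_separating P Z F \<longleftrightarrow>
     length F = length Z \<and>
     (\<exists>H. length H = length Z \<and> set H \<subseteq> carrier P \<and>
        (\<forall>i<length Z. F ! i = Var (Z ! i) - H ! i) \<and>
        (\<forall>i<length Z. \<forall>j<length Z. \<forall>t\<in>Poly_Mapping.keys (H ! j).
           \<not> pp_dvd (Poly_Mapping.single (Z ! i) 1) t))"

text \<open>
  Rewriting by \<open>F\<close> replaces each \<open>z\<^sub>i\<close> by \<open>h\<^sub>i\<close>, which is recovered from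
  \<open>f\<^sub>i = z\<^sub>i - h\<^sub>i\<close> as \<open>z\<^sub>i - f\<^sub>i\<close>.
\<close>

definition rewrite_poly :: "nat list \<Rightarrow> 'k::field mpoly list \<Rightarrow> 'k mpoly \<Rightarrow> 'k mpoly" where
  "rewrite_poly Z F =
     subst_vars (\<lambda>x. case map_of (zip Z F) x of None \<Rightarrow> Var x | Some f \<Rightarrow> Var x - f)"

definition rewrite_tuple ::
    "nat list \<Rightarrow> 'k::field mpoly list \<Rightarrow> 'k mpoly list \<Rightarrow> 'k mpoly list" where
  "rewrite_tuple Z F G = map (rewrite_poly Z F) G"

lemma cring_poly_ring: "cring (poly_ring V :: 'k::field mpoly ring)"
proof (rule cringI)
  show "abelian_group (poly_ring V :: 'k mpoly ring)"
  proof (rule abelian_groupI)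
    fix p q :: "'k mpoly"
    assume "p \<in> carrier (poly_ring V)" "q \<in> carrier (poly_ring V)"
    then show "p \<oplus>\<^bsub>poly_ring V\<^esub> q \<in> carrier (poly_ring V)"
      using Poly_Mapping.keys_add[of p q] by (fastforce simp: poly_ring_def)
  next
    fix p :: "'k mpoly"
    assume "p \<in> carrier (poly_ring V)"
    then have "- p \<in> carrier (poly_ring V)" "- p + p = 0"
      by (auto simp: poly_ring_def)
    then show "\<exists>q\<in>carrier (poly_ring V). q \<oplus>\<^bsub>poly_ring V\<^esub> p = \<zero>\<^bsub>poly_ring V\<^esub>"
      by (intro bexI[of _ "- p"]) (simp_all add: poly_ring_def)
  qed (auto simp: poly_ring_def algebra_simps)
  show "comm_monoid (poly_ring V :: 'k mpoly ring)"
  proof (rule comm_monoidI)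
    fix p q :: "'k mpoly"
    assume *: "p \<in> carrier (poly_ring V)" "q \<in> carrier (poly_ring V)"
    have "Poly_Mapping.keys t \<subseteq> V" if "t \<in> Poly_Mapping.keys (p * q)" for t
    proof -
      from that obtain a b where t: "t = a + b"
        and "a \<in> Poly_Mapping.keys p" "b \<in> Poly_Mapping.keys q"
        using Poly_Mapping.keys_mult[of p q] by blast
      with * have "Poly_Mapping.keys a \<subseteq> V" "Poly_Mapping.keys b \<subseteq> V"
        by (auto simp: poly_ring_def)
      then show ?thesis
        using Poly_Mapping.keys_add[of a b] unfolding t by blast
    qed
    then show "p \<otimes>\<^bsub>poly_ring V\<^esub> q \<in> carrier (poly_ring V)"
      by (simp add: poly_ring_def)
  qed (auto simp: poly_ring_def algebra_simps)
qed (auto simp: poly_ring_def algebra_simps)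

end

theory Submission
  imports Defs
begin

text \<open>
  Coherence puts all \<open>h\<^sub>i\<close> in \<open>K[X \ Z]\<close>, so rewriting by \<open>F\<close> is a ring
  homomorphism from \<open>P\<close> to \<open>K[X \ Z]\<close> that is the identity on \<open>K[X \ Z]\<close>. Every
  polynomial is congruent to its image modulo the ideal generated by \<open>F\<close>, hence modulo
  \<open>I\<close>. So the homomorphism maps \<open>I\<close> onto \<open>I \<inter> K[X \ Z]\<close>, and the image of
  an ideal under a surjective homomorphism is generated by the images of generators.
\<close>

section \<open>Substitution homomorphisms\<close>

definition subst_pp :: "(nat \<Rightarrow> 'k::field mpoly) \<Rightarrow> pp \<Rightarrow> 'k mpoly" where
  "subst_pp \<sigma> t = (\<Prod>i\<in>Poly_Mapping.keys t. \<sigma> i ^ Poly_Mapping.lookup t i)"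

text \<open>An index outside the support contributes \<open>\<sigma> i ^ 0 = 1\<close>. The free
  choice of \<open>A\<close> lets \<open>s\<close>, \<open>t\<close> and \<open>s + t\<close> be
  expanded over one index set.\<close>

lemma subst_pp_superset:
  assumes "finite A" "Poly_Mapping.keys t \<subseteq> A"
  shows "subst_pp \<sigma> t = (\<Prod>i\<in>A. \<sigma> i ^ Poly_Mapping.lookup t i)"
  unfolding subst_pp_def
  by (rule prod.mono_neutral_left) (use assms in \<open>auto simp: in_keys_iff\<close>)

lemma subst_pp_add: "subst_pp \<sigma> (s + t) = subst_pp \<sigma> s * subst_pp \<sigma> t"
proof -
  let ?A = "Poly_Mapping.keys s \<union> Poly_Mapping.keys t"
  have "Poly_Mapping.keys (s + t) \<subseteq> ?A"
    by (rule Poly_Mapping.keys_add)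
  then show ?thesis
    by (simp add: subst_pp_superset[of ?A] lookup_add power_add prod.distrib)
qed

lemma Const_add: "Const (a + b) = Const a + Const b"
  by (simp add: Const_def single_add)

lemma Const_mult: "Const (a * b) = Const a * Const b"
  by (simp add: Const_def mult_single)

lemma Const_zero [simp]: "Const 0 = 0"
  by (simp add: Const_def)

text \<open>Power products outside the support have coefficient 0. Since terms can cancel in
  \<open>p + q\<close>, additivity is proved over the union of the two supports instead.\<close>

lemma subst_vars_superset:
  assumes "finite A" "Poly_Mapping.keys p \<subseteq> A"
  shows "subst_vars \<sigma> p = (\<Sum>t\<in>A. Const (Poly_Mapping.lookup p t) * subst_pp \<sigma> t)"
  unfolding subst_vars_def subst_pp_def [symmetric]
  by (rule sum.mono_neutral_left) (use assms in \<open>auto simp: in_keys_iff\<close>)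

lemma subst_vars_add: "subst_vars \<sigma> (p + q) = subst_vars \<sigma> p + subst_vars \<sigma> q"
proof -
  let ?A = "Poly_Mapping.keys p \<union> Poly_Mapping.keys q"
  have "Poly_Mapping.keys (p + q) \<subseteq> ?A"
    by (rule Poly_Mapping.keys_add)
  then show ?thesis
    by (simp add: subst_vars_superset[of ?A] lookup_add Const_add distrib_right sum.distrib)
qed

lemma subst_vars_zero [simp]: "subst_vars \<sigma> 0 = 0"
  by (simp add: subst_vars_def)

lemma subst_vars_sum: "subst_vars \<sigma> (sum f A) = (\<Sum>x\<in>A. subst_vars \<sigma> (f x))"
  by (induction A rule: infinite_finite_induct) (simp_all add: subst_vars_add)

lemma subst_vars_single: "subst_vars \<sigma> (Poly_Mapping.single t c) = Const c * subst_pp \<sigma> t"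
  by (cases "c = 0") (simp_all add: subst_vars_def subst_pp_def)

text \<open>Serves at two levels: it splits a polynomial into its terms, and in
  \<open>subst_pp_Var\<close> it splits an exponent vector into its coordinates.\<close>

lemma sum_single_lookup: "(\<Sum>t\<in>Poly_Mapping.keys p. Poly_Mapping.single t (Poly_Mapping.lookup p t)) = p"
proof (rule poly_mapping_eqI)
  fix s
  have "Poly_Mapping.lookup
      (\<Sum>t\<in>Poly_Mapping.keys p. Poly_Mapping.single t (Poly_Mapping.lookup p t)) s =
      (\<Sum>t\<in>Poly_Mapping.keys p. if t = s then Poly_Mapping.lookup p t else 0)"
    by (simp add: lookup_sum lookup_single when_def)
  also have "\<dots> = Poly_Mapping.lookup p s"
    by (simp add: in_keys_iff)
  finally show "Poly_Mapping.lookup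
      (\<Sum>t\<in>Poly_Mapping.keys p. Poly_Mapping.single t (Poly_Mapping.lookup p t)) s =
      Poly_Mapping.lookup p s" .
qed

text \<open>Expanding both factors into terms first reduces the claim to products of two terms, so
  the coefficients of \<open>p * q\<close> never have to be computed.\<close>

lemma subst_vars_mult: "subst_vars \<sigma> (p * q) = subst_vars \<sigma> p * subst_vars \<sigma> q"
proof -
  let ?c = "Poly_Mapping.lookup p" and ?d = "Poly_Mapping.lookup q"
  have "p * q = (\<Sum>s\<in>Poly_Mapping.keys p. Poly_Mapping.single s (?c s)) *
      (\<Sum>t\<in>Poly_Mapping.keys q. Poly_Mapping.single t (?d t))"
    by (simp add: sum_single_lookup)
  also have "\<dots> = (\<Sum>s\<in>Poly_Mapping.keys p. \<Sum>t\<in>Poly_Mapping.keys q.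
      Poly_Mapping.single (s + t) (?c s * ?d t))"
    by (simp add: sum_product mult_single)
  finally have "subst_vars \<sigma> (p * q) = (\<Sum>s\<in>Poly_Mapping.keys p. \<Sum>t\<in>Poly_Mapping.keys q.
      (Const (?c s) * subst_pp \<sigma> s) * (Const (?d t) * subst_pp \<sigma> t))"
    by (simp add: subst_vars_sum subst_vars_single subst_pp_add Const_mult mult_ac)
  also have "\<dots> = subst_vars \<sigma> p * subst_vars \<sigma> q"
    by (simp add: subst_vars_def subst_pp_def sum_product)
  finally show ?thesis .
qed

lemma Var_power: "Var i ^ m = Poly_Mapping.single (Poly_Mapping.single i m) 1"
  by (induction m) (simp_all add: Var_def mult_single single_add [symmetric])

lemma prod_single_one:
  "finite A \<Longrightarrow> (\<Prod>i\<in>A. Poly_Mapping.single (f i) (1::'k::field)) = Poly_Mapping.single (sum f A) 1"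
  by (induction A rule: finite_induct) (simp_all add: mult_single)

lemma subst_pp_Var: "subst_pp Var t = Poly_Mapping.single t 1"
  by (simp add: subst_pp_def Var_power prod_single_one sum_single_lookup)

lemma subst_vars_Var: "subst_vars Var p = p"
proof -
  have "subst_vars Var p =
      (\<Sum>t\<in>Poly_Mapping.keys p. Poly_Mapping.single t (Poly_Mapping.lookup p t))"
    unfolding subst_vars_def subst_pp_def [symmetric]
    by (simp add: subst_pp_Var Const_def mult_single)
  then show ?thesis
    by (simp add: sum_single_lookup)
qed

lemma subst_vars_cong:
  assumes "p \<in> carrier (poly_ring V)" "\<And>i. i \<in> V \<Longrightarrow> \<sigma> i = \<tau> i"
  shows "subst_vars \<sigma> p = subst_vars \<tau> p"
  unfolding subst_vars_def
  by (intro sum.cong refl arg_cong2[where f = "(*)"] prod.cong)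
    (use assms in \<open>auto simp: poly_ring_def subset_iff\<close>)

section \<open>Ideals of polynomial rings\<close>

lemma poly_ring_simps [simp]:
  "x \<otimes>\<^bsub>poly_ring V\<^esub> y = x * y" "\<one>\<^bsub>poly_ring V\<^esub> = 1"
  "x \<oplus>\<^bsub>poly_ring V\<^esub> y = x + y" "\<zero>\<^bsub>poly_ring V\<^esub> = 0"
  by (simp_all add: poly_ring_def)

lemma poly_ring_mono: "V \<subseteq> W \<Longrightarrow> carrier (poly_ring V) \<subseteq> carrier (poly_ring W)"
  by (auto simp: poly_ring_def)

context
  fixes V :: "nat set" and C :: "'k::field mpoly set"
  defines "C \<equiv> carrier (poly_ring V)"
begin

interpretation R: cring "poly_ring V :: 'k mpoly ring"
  by (rule cring_poly_ring)

lemma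
  shows poly_ring_zero: "0 \<in> C"
    and poly_ring_one: "1 \<in> C"
    and poly_ring_add: "p \<in> C \<Longrightarrow> q \<in> C \<Longrightarrow> p + q \<in> C"
    and poly_ring_mult: "p \<in> C \<Longrightarrow> q \<in> C \<Longrightarrow> p * q \<in> C"
  using R.zero_closed R.one_closed R.a_closed R.m_closed by (simp_all add: C_def)

lemma poly_ring_uminus: "p \<in> C \<Longrightarrow> - p \<in> C"
  by (simp add: C_def poly_ring_def)

lemma poly_ring_Const: "Const c \<in> C"
  by (auto simp: C_def poly_ring_def Const_def)

lemma poly_ring_Var: "i \<in> V \<Longrightarrow> Var i \<in> C"
  by (auto simp: C_def poly_ring_def Var_def)

lemma poly_ring_power: "p \<in> C \<Longrightarrow> p ^ m \<in> C"
  by (induction m) (simp_all add: poly_ring_one poly_ring_mult)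

lemma poly_ring_prod: "(\<And>x. x \<in> A \<Longrightarrow> f x \<in> C) \<Longrightarrow> prod f A \<in> C"
  by (induction A rule: infinite_finite_induct) (simp_all add: poly_ring_one poly_ring_mult)

lemma poly_ring_sum: "(\<And>x. x \<in> A \<Longrightarrow> f x \<in> C) \<Longrightarrow> sum f A \<in> C"
  by (induction A rule: infinite_finite_induct) (simp_all add: poly_ring_zero poly_ring_add)

lemma subst_vars_closed:
  assumes "p \<in> carrier (poly_ring W)" "\<And>i. i \<in> W \<Longrightarrow> \<sigma> i \<in> C"
  shows "subst_vars \<sigma> p \<in> C"
  unfolding subst_vars_def
  by (intro poly_ring_sum poly_ring_mult poly_ring_Const poly_ring_prod poly_ring_power)
    (use assms in \<open>auto simp: poly_ring_def subset_iff\<close>)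

text \<open>Trades the record-based notion of ideal for closure conditions in the operations
  \<open>+\<close> and \<open>*\<close> of the type. Negatives come from multiplying by -1, right
  multiples from commutativity.\<close>

lemma ideal_poly_ring_iff:
  "ideal J (poly_ring V) \<longleftrightarrow> J \<subseteq> C \<and> 0 \<in> J \<and> (\<forall>a\<in>J. \<forall>b\<in>J. a + b \<in> J) \<and>
     (\<forall>a\<in>J. \<forall>x\<in>C. x * a \<in> J)" (is "_ \<longleftrightarrow> ?rhs")
proof
  assume "ideal J (poly_ring V)"
  then interpret J: ideal J "poly_ring V" .
  show ?rhs
    using J.a_subset J.zero_closed J.a_closed J.I_l_closed by (auto simp: C_def)
next
  assume r: ?rhs
  show "ideal J (poly_ring V)"
  proof (rule idealI)
    show "subgroup J (add_monoid (poly_ring V))"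
    proof (rule group.subgroupI)
      show "Group.group (add_monoid (poly_ring V :: 'k mpoly ring))"
        by (rule R.a_group)
      fix a assume a: "a \<in> J"
      \<comment> \<open>The record has no field for negation; its additive inverse agrees with
        \<open>- a\<close> by uniqueness of inverses.\<close>
      have "\<ominus>\<^bsub>poly_ring V\<^esub> a = - a"
        using r a poly_ring_uminus[of a]
        by (intro R.minus_equality) (auto simp: C_def)
      moreover have "- a \<in> J"
        using r a poly_ring_uminus[OF poly_ring_one] by (metis mult_minus1)
      ultimately show "inv\<^bsub>add_monoid (poly_ring V)\<^esub> a \<in> J"
        by (simp add: a_inv_def)
    qed (use r in \<open>auto simp: C_def\<close>)
  qed (use r R.ring_axioms in \<open>auto simp: C_def mult.commute\<close>)
qed

section \<open>Congruences modulo an ideal\<close>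

context
  fixes J :: "'k mpoly set"
  assumes J: "ideal J (poly_ring V)"
begin

lemma ideal_add: "a \<in> J \<Longrightarrow> b \<in> J \<Longrightarrow> a + b \<in> J"
  and ideal_mult_left: "a \<in> J \<Longrightarrow> x \<in> C \<Longrightarrow> x * a \<in> J"
  and ideal_zero: "0 \<in> J"
  using J by (simp_all add: ideal_poly_ring_iff)

lemma ideal_uminus: "a \<in> J \<Longrightarrow> - a \<in> J"
  using ideal_mult_left[of a "-1"] poly_ring_uminus[OF poly_ring_one] by simp

lemma ideal_sum: "(\<And>x. x \<in> A \<Longrightarrow> f x \<in> J) \<Longrightarrow> sum f A \<in> J"
  by (induction A rule: infinite_finite_induct) (simp_all add: ideal_zero ideal_add)

lemma ideal_mult_diff:
  assumes "p - p' \<in> J" "q - q' \<in> J" "q \<in> C" "p' \<in> C"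
  shows "p * q - p' * q' \<in> J"
proof -
  \<comment> \<open>Pass through the intermediate product \<open>p' * q\<close>; only the cofactors
    \<open>q\<close> and \<open>p'\<close> then need to lie in the ring.\<close>
  have "p * q - p' * q' = q * (p - p') + p' * (q - q')"
    by (simp add: algebra_simps)
  then show ?thesis
    using assms by (simp add: ideal_add ideal_mult_left)
qed

lemma ideal_power_diff:
  assumes "p - q \<in> J" "p \<in> C" "q \<in> C"
  shows "p ^ m - q ^ m \<in> J"
  by (induction m) (use assms in \<open>simp_all add: ideal_zero ideal_mult_diff poly_ring_power\<close>)

lemma ideal_prod_diff:
  assumes "\<And>x. x \<in> A \<Longrightarrow> f x - g x \<in> J" "\<And>x. x \<in> A \<Longrightarrow> f x \<in> C" "\<And>x. x \<in> A \<Longrightarrow> g x \<in> C"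
  shows "prod f A - prod g A \<in> J"
  using assms
  by (induction A rule: infinite_finite_induct)
    (simp_all add: ideal_zero ideal_mult_diff poly_ring_prod)

text \<open>Substitution uses only ring operations, and these respect congruence modulo
  \<open>J\<close>. With \<open>\<tau> = Var\<close> it compares a polynomial with its rewritten
  form.\<close>

lemma ideal_subst_vars_diff:
  assumes p: "p \<in> carrier (poly_ring W)"
    and "\<And>i. i \<in> W \<Longrightarrow> \<sigma> i - \<tau> i \<in> J" "\<And>i. i \<in> W \<Longrightarrow> \<sigma> i \<in> C" "\<And>i. i \<in> W \<Longrightarrow> \<tau> i \<in> C"
  shows "subst_vars \<sigma> p - subst_vars \<tau> p \<in> J"
proof -
  have "Const c * subst_pp \<sigma> t - Const c * subst_pp \<tau> t \<in> J" if "t \<in> Poly_Mapping.keys p" for c t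
  proof -
    have "Poly_Mapping.keys t \<subseteq> W"
      using p that by (simp add: poly_ring_def)
    then have "subst_pp \<sigma> t - subst_pp \<tau> t \<in> J"
      unfolding subst_pp_def
      by (intro ideal_prod_diff ideal_power_diff poly_ring_power) (use assms in auto)
    then show ?thesis
      by (simp add: right_diff_distrib [symmetric] ideal_mult_left poly_ring_Const)
  qed
  then show ?thesis
    by (simp add: subst_vars_def subst_pp_def [symmetric] sum_subtractf [symmetric] ideal_sum)
qed

end

end

text \<open>The preimage of an ideal under a ring homomorphism. It reduces the claim that a
  generated ideal is mapped into \<open>J\<close> to a check on generators.\<close>

lemma ideal_subst_vars_vimage:
  assumes J: "ideal J (poly_ring V)"
    and \<sigma>: "\<And>i. i \<in> W \<Longrightarrow> \<sigma> i \<in> carrier (poly_ring V)"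
  shows "ideal {p \<in> carrier (poly_ring W). subst_vars \<sigma> p \<in> J} (poly_ring W)"
  using subst_vars_closed[of _ W \<sigma> V, OF _ \<sigma>]
  by (auto simp: ideal_poly_ring_iff subst_vars_add subst_vars_mult poly_ring_zero poly_ring_add
      poly_ring_mult ideal_zero[OF J] ideal_add[OF J] ideal_mult_left[OF J])

lemma ideal_restrict:
  assumes J: "ideal J (poly_ring W)" and "V \<subseteq> W"
  shows "ideal (J \<inter> carrier (poly_ring V)) (poly_ring V)"
  using poly_ring_mono[OF \<open>V \<subseteq> W\<close>]
  by (auto simp: ideal_poly_ring_iff poly_ring_zero poly_ring_add
      poly_ring_mult ideal_zero[OF J] ideal_add[OF J] ideal_mult_left[OF J])

text \<open>The core argument without \<open>Z\<close> and \<open>F\<close>: all that matters is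
  that \<sigma> retracts the larger polynomial ring onto the smaller one and moves each
  indeterminate only within its class modulo the ideal.\<close>

lemma retract_ideal_generators:
  fixes G :: "'k::field mpoly set"
  assumes VW: "V \<subseteq> W" and G: "G \<subseteq> carrier (poly_ring W)"
    and \<sigma>: "\<And>i. i \<in> W \<Longrightarrow> \<sigma> i \<in> carrier (poly_ring V)"
    and \<sigma>_Var: "\<And>i. i \<in> V \<Longrightarrow> \<sigma> i = Var i"
    and \<sigma>_cong: "\<And>i. i \<in> W \<Longrightarrow> \<sigma> i - Var i \<in> Idl\<^bsub>poly_ring W\<^esub> G"
  shows "Idl\<^bsub>poly_ring V\<^esub> (subst_vars \<sigma> ` G) = Idl\<^bsub>poly_ring W\<^esub> G \<inter> carrier (poly_ring V)"
proof
  let ?I = "Idl\<^bsub>poly_ring W\<^esub> G" and ?J = "Idl\<^bsub>poly_ring V\<^esub> (subst_vars \<sigma> ` G)"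
  interpret W: cring "poly_ring W :: 'k mpoly ring"
    by (rule cring_poly_ring)
  interpret V: cring "poly_ring V :: 'k mpoly ring"
    by (rule cring_poly_ring)
  have I: "ideal ?I (poly_ring W)"
    using G by (rule W.genideal_ideal)
  have img: "subst_vars \<sigma> ` G \<subseteq> carrier (poly_ring V)"
    using G subst_vars_closed[of _ W \<sigma> V] \<sigma> by auto
  have J: "ideal ?J (poly_ring V)"
    using img by (rule V.genideal_ideal)
  \<comment> \<open>The identity substitution \<open>Var\<close> fixes \<open>g\<close>, so the
    image of \<open>g\<close> is \<open>g\<close> plus an element of the ideal.\<close>
  have "subst_vars \<sigma> g \<in> ?I" if "g \<in> G" for g
  proof -
    have "subst_vars \<sigma> g - subst_vars Var g \<in> ?I"
      using I _ \<sigma>_cong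
      by (rule ideal_subst_vars_diff)
        (use that G \<sigma> poly_ring_mono[OF VW] in \<open>auto simp: poly_ring_Var\<close>)
    then have "(subst_vars \<sigma> g - g) + g \<in> ?I"
      using that W.genideal_self[OF G] by (intro ideal_add[OF I]) (auto simp: subst_vars_Var)
    then show ?thesis by simp
  qed
  then show "?J \<subseteq> ?I \<inter> carrier (poly_ring V)"
    using img by (intro V.genideal_minimal ideal_restrict[OF I VW]) auto
  \<comment> \<open>The preimage of \<open>?J\<close> is an ideal containing \<open>G\<close>, hence
    all of \<open>?I\<close>. An element of \<open>?I\<close> in the smaller ring equals its own
    image, so it lies in \<open>?J\<close>.\<close>
  have "?I \<subseteq> {p \<in> carrier (poly_ring W). subst_vars \<sigma> p \<in> ?J}"
    using G V.genideal_self[OF img]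
    by (intro W.genideal_minimal ideal_subst_vars_vimage[OF J] \<sigma>) auto
  moreover have "subst_vars \<sigma> p = p" if "p \<in> carrier (poly_ring V)" for p
    using subst_vars_cong[OF that \<sigma>_Var] by (simp add: subst_vars_Var)
  ultimately show "?I \<inter> carrier (poly_ring V) \<subseteq> ?J"
    by fastforce
qed

section \<open>Coherently separating tuples\<close>

lemma pp_dvd_single: "pp_dvd (Poly_Mapping.single i 1) t \<longleftrightarrow> i \<in> Poly_Mapping.keys t"
proof
  assume "i \<in> Poly_Mapping.keys t"
  \<comment> \<open>Subtraction of exponents is truncated, but nothing is lost because the exponent
    of \<open>i\<close> in \<open>t\<close> is at least 1.\<close>
  then have "t = Poly_Mapping.single i 1 + (t - Poly_Mapping.single i 1)"
    by (intro poly_mapping_eqI)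
      (auto simp: lookup_add lookup_minus lookup_single in_keys_iff when_def)
  then show "pp_dvd (Poly_Mapping.single i 1) t"
    unfolding pp_dvd_def by blast
qed (auto simp: pp_dvd_def in_keys_iff lookup_add lookup_single)

text \<open>The polynomial in question is \<open>H ! i\<close>. Coherence bars every entry of
  \<open>Z\<close> from it, not only \<open>Z ! i\<close>, so one simultaneous substitution removes
  all of \<open>Z\<close>.\<close>

lemma coherently_separating_closed:
  assumes "coherently_separating (poly_ring W) Z F" "i < length Z"
  shows "Var (Z ! i) - F ! i \<in> carrier (poly_ring (W - set Z))"
proof -
  from assms obtain H where H: "length H = length Z" "set H \<subseteq> carrier (poly_ring W)"
    "\<forall>i<length Z. F ! i = Var (Z ! i) - H ! i"
    "\<forall>i<length Z. \<forall>j<length Z. \<forall>t\<in>Poly_Mapping.keys (H ! j). Z ! i \<notin> Poly_Mapping.keys t"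
    unfolding coherently_separating_def pp_dvd_single by auto
  have "H ! i \<in> carrier (poly_ring W)"
    using H assms(2) by (metis nth_mem subsetD)
  moreover have "\<forall>t\<in>Poly_Mapping.keys (H ! i). Poly_Mapping.keys t \<inter> set Z = {}"
    using H(4) assms(2) by (fastforce simp: in_set_conv_nth)
  ultimately have "H ! i \<in> carrier (poly_ring (W - set Z))"
    by (fastforce simp: poly_ring_def)
  with H(3) assms(2) show ?thesis by simp
qed

theorem proposition2p4:
  fixes n :: nat
    and P :: "'k::field mpoly ring"
    and R :: "'k mpoly ring"
    and I :: "'k mpoly set"
    and Z :: "nat list"
    and F G :: "'k mpoly list"
  assumes "P = poly_ring {1..n}"
    and "set G \<subseteq> carrier P"
    and "I = Idl\<^bsub>P\<^esub> (set G)"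
    and "distinct Z" and "set Z \<subseteq> {1..n}"
    and "coherently_separating P Z F" and "set F \<subseteq> I"
    and "R = poly_ring ({1..n} - set Z)"
  shows "set (rewrite_tuple Z F G) \<subseteq> carrier R
         \<and> Idl\<^bsub>R\<^esub> (set (rewrite_tuple Z F G)) = I \<inter> carrier R"
proof -
  let ?W = "{1..n}" and ?V = "{1..n} - set Z"
  define \<sigma> where "\<sigma> = (\<lambda>x. case map_of (zip Z F) x of None \<Rightarrow> Var x | Some f \<Rightarrow> Var x - f)"
  have len: "length F = length Z"
    using assms(6) by (simp add: coherently_separating_def)
  have ideal_I: "ideal I (poly_ring ?W)"
    using assms(1-3) ring.genideal_ideal[OF cring.axioms(1)[OF cring_poly_ring]] by metis
  \<comment> \<open>Distinctness of \<open>Z\<close> matters here: \<open>map_of\<close> returns the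
    first match, which is then the entry at position \<open>j\<close>.\<close>
  have \<sigma>_Z: "\<sigma> (Z ! j) = Var (Z ! j) - F ! j" if "j < length Z" for j
    using that len \<open>distinct Z\<close> by (simp add: \<sigma>_def map_of_zip_nth)
  have \<sigma>_Var: "\<sigma> i = Var i" if "i \<notin> set Z" for i
    using that len by (simp add: \<sigma>_def split: option.split) (metis in_set_zipE map_of_SomeD)
  have \<sigma>_closed: "\<sigma> i \<in> carrier (poly_ring ?V)" if "i \<in> ?W" for i
  proof (cases "i \<in> set Z")
    case True
    then obtain j where "j < length Z" "i = Z ! j"
      by (auto simp: in_set_conv_nth)
    then show ?thesis
      using coherently_separating_closed assms(1,6) by (metis \<sigma>_Z)
  next
    case False
    with that show ?thesis
      by (simp add: \<sigma>_Var poly_ring_Var)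
  qed
  \<comment> \<open>On \<open>Z ! j\<close> the difference is \<open>- F ! j\<close>, which lies in
    \<open>I\<close> by hypothesis; on all other indeterminates it is 0.\<close>
  have \<sigma>_cong: "\<sigma> i - Var i \<in> I" for i
  proof (cases "i \<in> set Z")
    case True
    then obtain j where j: "j < length Z" "i = Z ! j"
      by (auto simp: in_set_conv_nth)
    then have "F ! j \<in> I"
      using \<open>set F \<subseteq> I\<close> len by (metis nth_mem subsetD)
    with j show ?thesis
      by (simp add: \<sigma>_Z ideal_uminus[OF ideal_I])
  next
    case False
    then show ?thesis
      by (simp add: \<sigma>_Var ideal_zero[OF ideal_I])
  qed
  have img: "set (rewrite_tuple Z F G) = subst_vars \<sigma> ` set G"
    by (simp add: rewrite_tuple_def rewrite_poly_def \<sigma>_def)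
  have "Idl\<^bsub>poly_ring ?V\<^esub> (subst_vars \<sigma> ` set G) =
      Idl\<^bsub>poly_ring ?W\<^esub> (set G) \<inter> carrier (poly_ring ?V)"
    using assms(1-3) \<sigma>_closed \<sigma>_Var \<sigma>_cong by (intro retract_ideal_generators) auto
  moreover have "subst_vars \<sigma> ` set G \<subseteq> carrier (poly_ring ?V)"
    using assms(1,2) subst_vars_closed[of _ ?W \<sigma> ?V] \<sigma>_closed by blast
  ultimately show ?thesis
    unfolding img assms(8) assms(3) assms(1) by blast
qed

end
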